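(* For all integers $n\geq 0$, $\overline{R_6^\ast}(6n+5)\equiv 0 \pmod{8}$.
   Context: An overpartition of $n$ is a partition of $n$ in which the first occurrence of each part size may optionally be overlined. For a positive integer $\ell$, $\overline{R_\ell^\ast}(n)$ denotes the number of overpartitions of $n$ in which no non-overlined part is divisible by $\ell$. Equivalently, with $f_k:=\prod_{i\geq 1}(1-q^{ki})$, one has $\sum_{n\geq 0}\overline{R_\ell^\ast}(n)q^n = \frac{f_2 f_\ell}{f_1^2}$. *)

theory Defs
  imports "HOL-Library.Multiset" "HOL-Number_Theory.Cong"
begin

text \<open>
  An overpartition is encoded as a pair \<open>(P, S)\<close>: \<open>P\<close> is the underlying partition (the multiset
  of all parts, overlined or not) and \<open>S\<close> is the set of those part sizes whose first occurrence
  is overlined.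
\<close>

definition overpartitions :: "nat \<Rightarrow> (nat multiset \<times> nat set) set" where
  "overpartitions n = {(P, S). (\<forall>k \<in># P. 0 < k) \<and> sum_mset P = n \<and> S \<subseteq> set_mset P}"

text \<open>Exactly one occurrence of each size in \<open>S\<close> is overlined; the remaining parts are not.\<close>

definition non_overlined_parts :: "nat multiset \<times> nat set \<Rightarrow> nat multiset" where
  "non_overlined_parts \<pi> = fst \<pi> - mset_set (snd \<pi>)"

definition R_star :: "nat \<Rightarrow> nat \<Rightarrow> nat" where
  "R_star l n = card {\<pi> \<in> overpartitions n. \<forall>k \<in># non_overlined_parts \<pi>. \<not> l dvd k}"

text \<open>The set counted by \<open>R_star\<close> is finite, so its \<open>card\<close> is the genuine cardinality.\<close>

lemma finite_overpartitions: "finite (overpartitions n)"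
proof -
  have size_le: "size P \<le> sum_mset P" if "\<forall>k \<in># P. 0 < k" for P :: "nat multiset"
    using that by (induction P) auto
  have "overpartitions n \<subseteq> (mset ` {xs. set xs \<subseteq> {..n} \<and> length xs \<le> n}) \<times> Pow {..n}"
  proof (clarify, intro conjI SigmaI)
    fix P S assume "(P, S) \<in> overpartitions n"
    then have pos: "\<forall>k \<in># P. 0 < k" and sum: "sum_mset P = n" and S: "S \<subseteq> set_mset P"
      by (auto simp: overpartitions_def)
    have le: "k \<le> n" if "k \<in># P" for k
      using that sum by (auto dest!: multi_member_split)
    obtain xs where xs: "P = mset xs" by (metis ex_mset)
    show "P \<in> mset ` {xs. set xs \<subseteq> {..n} \<and> length xs \<le> n}"
      using le size_le[OF pos] sum xs by auto
    show "S \<in> Pow {..n}" using S le by auto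
  qed
  then show ?thesis
    by (rule finite_subset) (simp add: finite_lists_length_le)
qed

end

theory Submission
  imports Defs "HOL-Computational_Algebra.Formal_Power_Series"
begin

text \<open>
  Gauss's identity \<open>f\<^sub>1\<^sup>2 / f\<^sub>2 = \<Sum> (-1)\<^sup>s q\<^bsup>s\<^sup>2\<^esup>\<close> (sum over all integers \<open>s\<close>) turns the
  generating function into \<open>f\<^sub>6 / (1 + 2 S)\<close> with \<open>S = \<Sum> (-1)\<^sup>s q\<^bsup>s\<^sup>2\<^esup>\<close> over \<open>s \<ge> 1\<close>. Modulo 8 this is
  \<open>f\<^sub>6 (1 - 2 S + 4 S\<^sup>2)\<close>, and \<open>f\<^sub>6\<close> is a series in \<open>q\<^sup>6\<close>, so only coefficients of \<open>S\<close> and \<open>S\<^sup>2\<close> at indices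
  \<open>i \<equiv> 5 (mod 6)\<close> matter. Those of \<open>S\<close> vanish because 2 is not a square modulo 3, and
  those of \<open>S\<^sup>2\<close> are even because \<open>i\<close> is odd.

  All identities are used in truncated form, modulo \<open>q\<^bsup>n+1\<^esup>\<close>, so that only finite products occur.
  Gauss's identity is the limit of
  \<open>\<Sum> (-1)\<^sup>j q\<^bsup>j\<^sup>2\<^esup> [2m, m+j]\<^sub>q = (1 - q) (1 - q\<^sup>3) \<cdots> (1 - q\<^bsup>2m-1\<^esup>)\<close>.
\<close>

section \<open>Gaussian binomial coefficients\<close>

text \<open>This is (q;q)_n with q = \<open>fps_X\<close>, a truncation of f_1.\<close>

definition qpoch :: "nat \<Rightarrow> int fps" where
  "qpoch n = (\<Prod>k = 1..n. 1 - fps_X ^ k)"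

text \<open>The q-Pascal recurrence yields integer series directly, without any division.\<close>

fun qbin :: "nat \<Rightarrow> nat \<Rightarrow> int fps" where
  "qbin n 0 = 1"
| "qbin 0 (Suc k) = 0"
| "qbin (Suc n) (Suc k) = qbin n k + fps_X ^ Suc k * qbin n (Suc k)"

lemma qpoch_0 [simp]: "qpoch 0 = 1"
  by (simp add: qpoch_def)

lemma qpoch_Suc: "qpoch (Suc n) = qpoch n * (1 - fps_X ^ Suc n)"
  by (simp add: qpoch_def)

lemma fps_nth_0_prod: "fps_nth (prod f A) 0 = (\<Prod>x\<in>A. fps_nth (f x) 0)"
  for f :: "'a \<Rightarrow> 'b::comm_ring_1 fps"
  by (induction A rule: infinite_finite_induct) auto

lemma qpoch_nth_0 [simp]: "fps_nth (qpoch n) 0 = 1"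
  by (auto simp: qpoch_def fps_nth_0_prod intro!: prod.neutral)

lemma qpoch_nonzero [simp]: "qpoch n \<noteq> 0"
  using qpoch_nth_0[of n] by fastforce

lemma qbin_eq_0 [simp]: "n < k \<Longrightarrow> qbin n k = 0"
  by (induction n k rule: qbin.induct) auto

text \<open>The quotient formula with denominators cleared. The induction step rests on (1 -
  q^(k+1)) + q^(k+1) (1 - q^(n-k)) = 1 - q^(n+1).\<close>

lemma qbin_qpoch: "k \<le> n \<Longrightarrow> qbin n k * qpoch k * qpoch (n - k) = qpoch n"
proof (induction n k rule: qbin.induct)
  case (3 n k)
  then have k: "k \<le> n" by simp
  have a: "qbin n k * qpoch k * qpoch (n - k) = qpoch n"
    using 3 by simp
  \<comment> \<open>The factor 1 - q^(n-k) lets this form cover k = n too, where both sides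
    vanish.\<close>
  have b: "qbin n (Suc k) * qpoch (Suc k) * qpoch (n - k) = qpoch n * (1 - fps_X ^ (n - k))"
  proof (cases "k = n")
    case False
    then have "n - k = Suc (n - Suc k)" using k by simp
    then show ?thesis
      using 3 k False by (metis Suc_leI mult.assoc nat_less_le qpoch_Suc)
  qed simp
  have "qbin (Suc n) (Suc k) * qpoch (Suc k) * qpoch (Suc n - Suc k)
      = qbin n k * qpoch k * qpoch (n - k) * (1 - fps_X ^ Suc k)
        + fps_X ^ Suc k * (qbin n (Suc k) * qpoch (Suc k) * qpoch (n - k))"
    by (simp add: qpoch_Suc algebra_simps)
  also have "\<dots> = qpoch n * (1 - fps_X ^ Suc k * fps_X ^ (n - k))"
    unfolding a b by (simp add: algebra_simps)
  also have "fps_X ^ Suc k * fps_X ^ (n - k) = (fps_X ^ Suc n :: int fps)"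
    using k by (simp flip: power_add power_Suc)
  finally show ?case by (simp only: qpoch_Suc)
qed auto

lemma qbin_symmetric:
  assumes "k \<le> n"
  shows "qbin n (n - k) = qbin n k"
proof -
  have "qbin n (n - k) * (qpoch k * qpoch (n - k)) = qbin n k * (qpoch k * qpoch (n - k))"
    using qbin_qpoch[of k n] qbin_qpoch[of "n - k" n] assms by (simp add: mult_ac)
  then show ?thesis by simp
qed

text \<open>The second q-Pascal rule is the defining one reflected by k -> n - k.\<close>

lemma qbin_Suc_Suc':
  assumes "k \<le> n"
  shows "qbin (Suc n) (Suc k) = fps_X ^ (n - k) * qbin n k + qbin n (Suc k)"
proof (cases "k = n")
  case True
  then show ?thesis using qbin_symmetric[of "Suc n" "Suc n"] qbin_symmetric[of n n] by simp
next
  case False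
  then have k: "n - k = Suc (n - Suc k)" using assms by simp
  have "qbin (Suc n) (Suc k) = qbin (Suc n) (n - k)"
    using qbin_symmetric[of "Suc k" "Suc n"] assms by simp
  also have "\<dots> = qbin n (n - Suc k) + fps_X ^ (n - k) * qbin n (n - k)"
    by (subst k, subst qbin.simps) (simp flip: k)
  finally show ?thesis
    using assms False by (simp add: qbin_symmetric)
qed

lemma qbin_absorption:
  "(1 - fps_X ^ Suc k) * qbin (Suc n) (Suc k) = (1 - fps_X ^ Suc n) * qbin n k"
proof (cases "k \<le> n")
  case True
  have "(1 - fps_X ^ Suc k) * qbin (Suc n) (Suc k) * (qpoch k * qpoch (n - k))
      = qbin (Suc n) (Suc k) * qpoch (Suc k) * qpoch (Suc n - Suc k)"
    by (simp add: qpoch_Suc mult_ac del: qbin.simps power_Suc)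
  also have "\<dots> = qpoch n * (1 - fps_X ^ Suc n)"
    using qbin_qpoch[of "Suc k" "Suc n"] True by (simp only: qpoch_Suc)
  also have "qpoch n = qbin n k * qpoch k * qpoch (n - k)"
    using qbin_qpoch[OF True] by simp
  finally have "((1 - fps_X ^ Suc k) * qbin (Suc n) (Suc k)) * (qpoch k * qpoch (n - k))
      = ((1 - fps_X ^ Suc n) * qbin n k) * (qpoch k * qpoch (n - k))"
    by (simp only: mult_ac)
  then show ?thesis by (simp del: qbin.simps power_Suc)
qed (simp del: power_Suc)

section \<open>Gauss's identity for the sum of signed squares\<close>

text \<open>The difference is squared in \<open>int\<close>, where it may be negative; the result is
  a \<open>nat\<close> so that it can be an exponent.\<close>

definition sq_dist :: "nat \<Rightarrow> nat \<Rightarrow> nat" where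
  "sq_dist m j = nat ((int m - int j)\<^sup>2)"

lemma int_sq_dist [simp]: "int (sq_dist m j) = (int m - int j)\<^sup>2"
  by (simp add: sq_dist_def)

lemma sq_dist_add [simp]: "sq_dist m (m + s) = s\<^sup>2" "sq_dist (m + s) m = s\<^sup>2"
  by (simp_all add: sq_dist_def nat_power_eq)

lemma sq_dist_Suc_Suc [simp]: "sq_dist (Suc m) (Suc j) = sq_dist m j"
  by (simp add: sq_dist_def)

text \<open>Matches the exponents in the induction below, so that two neighbouring terms combine
  into a factor 1 - q^j.\<close>

lemma sq_dist_shift:
  assumes "j \<le> Suc (2 * m)"
  shows "sq_dist m j + (Suc (2 * m) - j) = sq_dist (Suc m) j + j"
proof -
  have "int (sq_dist m j + (Suc (2 * m) - j)) = int (sq_dist (Suc m) j + j)"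
    using assms by (simp add: of_nat_diff power2_eq_square algebra_simps)
  then show ?thesis by linarith
qed

text \<open>The summation index is shifted by \<open>m\<close>, which accounts for the sign \<open>(-1)\<^sup>m\<close>.\<close>

lemma sum_signed_squares_qbin:
  "(\<Sum>j\<le>2 * m. (-1) ^ j * fps_X ^ sq_dist m j * qbin (2 * m) j)
     = (-1) ^ m * (\<Prod>i<m. 1 - fps_X ^ Suc (2 * i))"
proof (induction m)
  case 0
  then show ?case by (simp add: sq_dist_def)
next
  case (Suc m)
  define N where "N = Suc (2 * m)"
  define w :: "nat \<Rightarrow> int fps" where "w j = (-1) ^ j * fps_X ^ sq_dist (Suc m) j" for j
  have "(\<Sum>j\<le>2 * Suc m. (-1) ^ j * fps_X ^ sq_dist (Suc m) j * qbin (2 * Suc m) j)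
      = (\<Sum>j\<le>Suc N. w j * qbin (Suc N) j)"
    by (simp add: w_def N_def)
  also have "\<dots> = w 0 + (\<Sum>j\<le>N. w (Suc j) * qbin (Suc N) (Suc j))"
    by (subst sum.atMost_Suc_shift) simp
  also have "(\<Sum>j\<le>N. w (Suc j) * qbin (Suc N) (Suc j))
      = (\<Sum>j\<le>N. w (Suc j) * fps_X ^ (N - j) * qbin N j) + (\<Sum>j\<le>N. w (Suc j) * qbin N (Suc j))"
    by (subst sum.distrib [symmetric], rule sum.cong)
      (auto simp: qbin_Suc_Suc' algebra_simps simp del: qbin.simps)
  also have "w 0 + (\<dots>) = (\<Sum>j\<le>N. w (Suc j) * fps_X ^ (N - j) * qbin N j)
      + (\<Sum>j\<le>Suc N. w j * qbin N j)"
    by (subst sum.atMost_Suc_shift[of "\<lambda>j. w j * qbin N j"]) simp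
  \<comment> \<open>The top term j = \<open>Suc N\<close> drops out because
    \<open>qbin N (Suc N)\<close> is 0.\<close>
  also have "\<dots> = (\<Sum>j\<le>N. (w (Suc j) * fps_X ^ (N - j) + w j) * qbin N j)"
    by (simp add: sum.distrib algebra_simps)
  also have "\<dots> = (\<Sum>j\<le>N. w j * ((1 - fps_X ^ j) * qbin N j))"
  proof (rule sum.cong)
    fix j assume "j \<in> {..N}"
    then have "fps_X ^ sq_dist m j * fps_X ^ (N - j) = fps_X ^ sq_dist (Suc m) j * (fps_X ^ j :: int fps)"
      using sq_dist_shift[of j m] by (simp add: N_def flip: power_add)
    then have "w (Suc j) * fps_X ^ (N - j) = - w j * fps_X ^ j"
      by (simp add: w_def mult.assoc)
    then show "(w (Suc j) * fps_X ^ (N - j) + w j) * qbin N j = w j * ((1 - fps_X ^ j) * qbin N j)"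
      by (simp add: algebra_simps)
  qed simp
  \<comment> \<open>The term j = 0 vanishes because of 1 - q^0 = 0.\<close>
  also have "\<dots> = (\<Sum>j\<le>2 * m. w (Suc j) * ((1 - fps_X ^ Suc j) * qbin N (Suc j)))"
    unfolding N_def by (subst sum.atMost_Suc_shift) simp
  \<comment> \<open>Absorption extracts 1 - q^N and lowers the binomial to [2m, j]; the shifted
    weight contributes the minus sign and restores \<open>sq_dist m j\<close>.\<close>
  also have "\<dots> = (\<Sum>j\<le>2 * m. - (1 - fps_X ^ N) *
      ((-1) ^ j * fps_X ^ sq_dist m j * qbin (2 * m) j))"
    unfolding N_def
    by (intro sum.cong refl, subst qbin_absorption) (simp add: w_def algebra_simps)
  also have "\<dots> = - (1 - fps_X ^ N) * ((-1) ^ m * (\<Prod>i<m. 1 - fps_X ^ Suc (2 * i)))"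
    by (subst sum_distrib_left [symmetric], subst Suc.IH) rule
  also have "\<dots> = (-1) ^ Suc m * (\<Prod>i<Suc m. 1 - fps_X ^ Suc (2 * i))"
    by (simp add: N_def algebra_simps)
  finally show ?case .
qed

section \<open>Truncated congruences and the limit of the finite identity\<close>

lemma fps_X_power_dvd_cancel:
  fixes u f :: "int fps"
  assumes "fps_nth u 0 = 1" "fps_X ^ k dvd u * f"
  shows "fps_X ^ k dvd f"
proof -
  have "fps_left_inverse u 1 * u = 1"
    using assms by (intro fps_left_inverse) simp
  then have "f = fps_left_inverse u 1 * (u * f)"
    by (simp flip: mult.assoc)
  then show ?thesis using assms(2) by (metis dvd_mult)
qed

lemma fps_X_power_dvd_nth: "fps_X ^ k dvd f \<Longrightarrow> i < k \<Longrightarrow> fps_nth f i = 0"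
  for f :: "int fps"
  by (auto simp: fps_X_power_mult_nth elim!: dvdE)

text \<open>Every factor with index beyond a is 1 modulo q^(a+1).\<close>

lemma qpoch_cong: "a \<le> b \<Longrightarrow> fps_X ^ Suc a dvd qpoch b - qpoch a"
proof (induction rule: dec_induct)
  case (step b)
  have "fps_X ^ Suc a dvd qpoch b * (fps_X ^ Suc b :: int fps)"
    using step by (intro dvd_mult le_imp_power_dvd) simp
  then have "fps_X ^ Suc a dvd (qpoch b - qpoch a) - qpoch b * fps_X ^ Suc b"
    by (rule dvd_diff[OF step.IH])
  then show ?case
    by (simp add: qpoch_Suc algebra_simps)
qed simp

text \<open>Modulo q^(c+1) every (q;q)_b with b \<ge> c agrees with E = (q;q)_c, so the product
  formula becomes [n,k] E^2 = E, and the unit E cancels.\<close>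

lemma qbin_qpoch_cong:
  assumes "c \<le> k" "c \<le> n - k" "k \<le> n" "c \<le> m"
  shows "fps_X ^ Suc c dvd qbin n k * qpoch m - 1"
proof -
  let ?q = "qbin n k" and ?E = "qpoch c"
  let ?X = "fps_X ^ Suc c :: int fps"
  have dv: "?X dvd qpoch b - ?E" if "c \<le> b" for b
    using qpoch_cong[OF that] .
  have "?E * (?q * ?E - 1) = (qpoch n - ?E)
      - (?q * (qpoch k * (qpoch (n - k) - ?E) + ?E * (qpoch k - ?E)))"
    by (simp flip: qbin_qpoch[OF assms(3)] add: algebra_simps)
  moreover have "?X dvd \<dots>"
    using assms by (intro dvd_diff dvd_add dvd_mult dv) auto
  ultimately have "?X dvd ?E * (?q * ?E - 1)" by simp
  then have "?X dvd ?q * ?E - 1"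
    by (rule fps_X_power_dvd_cancel[rotated]) simp
  moreover have "?X dvd ?q * (qpoch m - ?E)"
    using assms by (intro dvd_mult dv)
  ultimately have "?X dvd (?q * ?E - 1) + ?q * (qpoch m - ?E)"
    by (rule dvd_add)
  then show ?thesis by (simp add: algebra_simps)
qed

text \<open>Since min(j, 2m-j) = m - |m-j| and |m-j| \<le> (m-j)^2, the weight q^((m-j)^2) makes up
  for the poor precision of [2m, j] away from the centre.\<close>

lemma sq_dist_bound:
  assumes "j \<le> 2 * m"
  shows "Suc m \<le> sq_dist m j + Suc (min j (2 * m - j))"
proof -
  have "\<bar>int m - int j\<bar> * 1 \<le> \<bar>int m - int j\<bar> * \<bar>int m - int j\<bar>"
    by (cases "m = j") (simp, intro mult_left_mono, auto)
  then have "\<bar>int m - int j\<bar> \<le> int (sq_dist m j)"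
    by (simp add: power2_eq_square abs_mult_self_eq)
  then show ?thesis using assms by linarith
qed

definition pos_squares :: "nat \<Rightarrow> int fps" where
  "pos_squares m = (\<Sum>s = 1..m. (-1) ^ s * fps_X ^ (s\<^sup>2))"

text \<open>The indices m - s and m + s carry the same term, whose sign is (-1)^m (-1)^s.\<close>

lemma sum_signed_squares:
  "(\<Sum>j\<le>2 * m. (-1) ^ j * fps_X ^ sq_dist m j) = (-1) ^ m * (1 + 2 * pos_squares m)"
proof -
  let ?f = "\<lambda>j. (-1) ^ j * fps_X ^ sq_dist m j :: int fps"
  let ?g = "\<lambda>s. (-1) ^ m * ((-1) ^ s * fps_X ^ (s\<^sup>2)) :: int fps"
  have split: "{..2 * m} = {..<m} \<union> {m} \<union> {m<..2 * m}" by auto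
  have "sum ?f {..2 * m} = sum ?f {..<m} + ?f m + sum ?f {m<..2 * m}"
    unfolding split by (subst sum.union_disjoint; force)+
  also have "sum ?f {..<m} = sum ?g {1..m}"
  proof (rule sum.reindex_bij_witness[of _ "\<lambda>s. m - s" "\<lambda>j. m - j"])
    fix j assume "j \<in> {..<m}"
    then obtain s where "m = j + s" by (metis less_imp_add_positive lessThan_iff)
    then show "?g (m - j) = ?f j"
      by (simp add: power_add mult_ac flip: power_mult_distrib)
  qed auto
  also have "sum ?f {m<..2 * m} = sum ?g {1..m}"
  proof (rule sum.reindex_bij_witness[of _ "\<lambda>s. m + s" "\<lambda>j. j - m"])
    fix j assume "j \<in> {m<..2 * m}"
    then obtain s where "j = m + s" by (metis greaterThanAtMost_iff less_imp_add_positive)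
    then show "?g (j - m) = ?f j"
      by (simp add: power_add mult_ac)
  qed auto
  also have "sum ?g {1..m} = (-1) ^ m * pos_squares m"
    by (simp add: pos_squares_def sum_distrib_left)
  finally show ?thesis by (simp add: sq_dist_def algebra_simps)
qed

text \<open>Each [2m, j] (q;q)_m in the finite identity is replaced by 1. The product on the left
  truncates f_1 (f_1 / f_2).\<close>

lemma gauss_squares_cong:
  "fps_X ^ Suc m dvd qpoch m * (\<Prod>i<m. 1 - fps_X ^ Suc (2 * i)) - (1 + 2 * pos_squares m)"
proof -
  let ?s = "\<lambda>j. (-1) ^ j * fps_X ^ sq_dist m j :: int fps"
  have "fps_X ^ Suc m dvd (\<Sum>j\<le>2 * m. ?s j * (qbin (2 * m) j * qpoch m - 1))"
  proof (rule dvd_sum)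
    fix j assume "j \<in> {..2 * m}"
    then have j: "j \<le> 2 * m" by simp
    let ?c = "min j (2 * m - j)"
    have "fps_X ^ Suc ?c dvd qbin (2 * m) j * qpoch m - 1"
      using j by (intro qbin_qpoch_cong) auto
    then have "fps_X ^ (sq_dist m j + Suc ?c) dvd fps_X ^ sq_dist m j * (qbin (2 * m) j * qpoch m - 1)"
      unfolding power_add by (intro mult_dvd_mono) auto
    then have "fps_X ^ Suc m dvd fps_X ^ sq_dist m j * (qbin (2 * m) j * qpoch m - 1)"
      using le_imp_power_dvd[OF sq_dist_bound[OF j]] dvd_trans by blast
    then show "fps_X ^ Suc m dvd ?s j * (qbin (2 * m) j * qpoch m - 1)"
      unfolding mult.assoc by (rule dvd_mult)
  qed
  also have "(\<Sum>j\<le>2 * m. ?s j * (qbin (2 * m) j * qpoch m - 1))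
      = qpoch m * (\<Sum>j\<le>2 * m. ?s j * qbin (2 * m) j) - (\<Sum>j\<le>2 * m. ?s j)"
    by (simp add: sum_distrib_left sum_subtractf algebra_simps)
  also have "\<dots> = (-1) ^ m * (qpoch m * (\<Prod>i<m. 1 - fps_X ^ Suc (2 * i)) - (1 + 2 * pos_squares m))"
    unfolding sum_signed_squares_qbin sum_signed_squares by (simp add: algebra_simps)
  finally show ?thesis
    by (cases "even m") (simp_all del: power_Suc minus_diff_eq)
qed

section \<open>The generating function\<close>

definition partitions_in :: "nat set \<Rightarrow> nat \<Rightarrow> nat multiset set" where
  "partitions_in B n = {M. set_mset M \<subseteq> B \<and> sum_mset M = n}"

definition distinct_in :: "nat set \<Rightarrow> nat \<Rightarrow> nat set set" where
  "distinct_in A n = {S. S \<subseteq> A \<and> \<Sum>S = n}"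

lemma finite_distinct_in: "finite A \<Longrightarrow> finite (distinct_in A n)"
  by (simp add: distinct_in_def)

text \<open>Overlining nothing embeds these partitions into \<open>overpartitions n\<close>; a part
  0 could be repeated without changing the sum.\<close>

lemma finite_partitions_in:
  assumes "0 \<notin> B"
  shows "finite (partitions_in B n)"
proof (rule finite_subset)
  show "partitions_in B n \<subseteq> fst ` overpartitions n"
  proof
    fix M assume "M \<in> partitions_in B n"
    with assms have "(M, {}) \<in> overpartitions n"
      by (auto simp: partitions_in_def overpartitions_def intro!: gr0I)
    then show "M \<in> fst ` overpartitions n" by force
  qed
qed (simp add: finite_overpartitions)

text \<open>Either k does not occur, or one copy of it can be removed. As series this says that
  multiplying by 1 - q^k removes k from the allowed parts.\<close>

lemma card_partitions_in_insert:
  assumes "0 \<notin> insert k B" "k \<notin> B"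
  shows "card (partitions_in (insert k B) n) = card (partitions_in B n)
    + (if k \<le> n then card (partitions_in (insert k B) (n - k)) else 0)"
proof -
  let ?C = "{M \<in> partitions_in (insert k B) n. k \<in># M}"
  have "partitions_in (insert k B) n = partitions_in B n \<union> ?C"
    by (auto simp: partitions_in_def)
  moreover have "partitions_in B n \<inter> ?C = {}"
    using assms by (auto simp: partitions_in_def)
  moreover have "finite (partitions_in (insert k B) n)" "finite (partitions_in B n)"
    using assms by (auto intro!: finite_partitions_in)
  ultimately have "card (partitions_in (insert k B) n) = card (partitions_in B n) + card ?C"
    by (metis (no_types, lifting) card_Un_disjoint finite_Un)
  moreover have "card ?C = (if k \<le> n then card (partitions_in (insert k B) (n - k)) else 0)"
  proof (cases "k \<le> n")
    case True
    have "?C = add_mset k ` partitions_in (insert k B) (n - k)"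
    proof (intro equalityI subsetI)
      fix M assume "M \<in> ?C"
      then have "M = add_mset k (M - {#k#})" "M - {#k#} \<in> partitions_in (insert k B) (n - k)"
        by (auto simp: partitions_in_def dest!: multi_member_split)
      then show "M \<in> add_mset k ` partitions_in (insert k B) (n - k)" by blast
    qed (use True in \<open>auto simp: partitions_in_def\<close>)
    then show ?thesis using True by (simp add: card_image inj_on_def)
  next
    case False
    then have "?C = {}" by (auto simp: partitions_in_def dest!: multi_member_split)
    then show ?thesis using False by (simp only: if_False card.empty)
  qed
  ultimately show ?thesis by simp
qed

lemma partitions_in_gf:
  assumes "finite B" "0 \<notin> B"
  shows "Abs_fps (\<lambda>n. int (card (partitions_in B n))) * (\<Prod>k\<in>B. 1 - fps_X ^ k) = 1"
  using assms
proof (induction B)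
  case empty
  have "partitions_in {} n = (if n = 0 then {{#}} else {})" for n
    by (auto simp: partitions_in_def)
  then show ?case by (intro fps_ext) simp
next
  case (insert k B)
  let ?P = "\<lambda>B. Abs_fps (\<lambda>n. int (card (partitions_in B n)))"
  have "?P (insert k B) * (1 - fps_X ^ k) = ?P B"
    using card_partitions_in_insert[of k B] insert
    by (intro fps_ext) (simp add: ring_distribs fps_X_power_mult_right_nth)
  then show ?case
    using insert by (simp flip: mult.assoc)
qed

text \<open>Expanding the product chooses a subset of A, which contributes q to the power of its
  sum.\<close>

lemma distinct_in_gf:
  assumes "finite A"
  shows "Abs_fps (\<lambda>n. int (card (distinct_in A n))) = (\<Prod>k\<in>A. 1 + fps_X ^ k)"
proof -
  have "(\<Prod>k\<in>A. 1 + fps_X ^ k) = (\<Sum>S\<in>Pow A. fps_X ^ \<Sum>S :: int fps)"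
    using prod_add[OF assms, of "\<lambda>k. fps_X ^ k" "\<lambda>_. 1 :: int fps"]
    by (simp add: power_sum add.commute)
  moreover have "fps_nth (\<Sum>S\<in>Pow A. fps_X ^ \<Sum>S) n = int (card (distinct_in A n))" for n
  proof -
    have "fps_nth (\<Sum>S\<in>Pow A. fps_X ^ \<Sum>S) n = (\<Sum>S\<in>Pow A. if n = \<Sum>S then 1 else 0 :: int)"
      by (simp add: fps_sum_nth fps_X_power_nth)
    also have "\<dots> = int (card (distinct_in A n))"
      using assms by (simp add: distinct_in_def sum.If_cases Int_def Pow_def eq_commute[of n])
    finally show ?thesis .
  qed
  ultimately show ?thesis by (intro fps_ext) simp
qed

text \<open>Detaching the overlined copies sends (P, S) to S and P - S; here i is the sum of S.
  Parts of a partition of n are at most n, so finite A and B suffice.\<close>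

lemma card_R_star:
  fixes l n :: nat
  defines "A \<equiv> {1..n}" and "B \<equiv> {k \<in> {1..n}. \<not> l dvd k}"
  shows "R_star l n = (\<Sum>i\<le>n. card (distinct_in A i) * card (partitions_in B (n - i)))"
proof -
  let ?R = "{\<pi> \<in> overpartitions n. \<forall>k \<in># non_overlined_parts \<pi>. \<not> l dvd k}"
  let ?T = "SIGMA i:{..n}. distinct_in A i \<times> partitions_in B (n - i)"
  have le: "k \<le> sum_mset P" if "k \<in># P" for k :: nat and P
    using that by (auto dest!: multi_member_split)
  have sum_S: "sum_mset (mset_set S) = \<Sum>S" for S :: "nat set"
    by (simp add: sum_unfold_sum_mset)
  have sub: "mset_set S \<subseteq># P" if "S \<subseteq> set_mset P" for S and P :: "nat multiset"
    using that by (auto simp: subseteq_mset_def count_mset_set' Suc_le_eq)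
  have "bij_betw (\<lambda>(P, S). (\<Sum>S, S, P - mset_set S)) ?R ?T"
  proof (rule bij_betw_byWitness[where f' = "\<lambda>(i, S, M). (M + mset_set S, S)"])
    show "\<forall>x\<in>?R. (case case x of (P, S) \<Rightarrow> (\<Sum>S, S, P - mset_set S) of
        (i, S, M) \<Rightarrow> (M + mset_set S, S)) = x"
      by (auto simp: overpartitions_def sub)
    show "\<forall>y\<in>?T. (case case y of (i, S, M) \<Rightarrow> (M + mset_set S, S) of
        (P, S) \<Rightarrow> (\<Sum>S, S, P - mset_set S)) = y"
      by (auto simp: distinct_in_def)
    show "(\<lambda>(P, S). (\<Sum>S, S, P - mset_set S)) ` ?R \<subseteq> ?T"
    proof (rule image_subsetI)
      fix x assume x: "x \<in> ?R"
      obtain P S where xPS: "x = (P, S)" by (cases x)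
      with x have PS: "(P, S) \<in> overpartitions n"
        and nd: "\<forall>k \<in># non_overlined_parts (P, S). \<not> l dvd k"
        by auto
      have pos: "\<forall>k\<in>#P. 0 < k" and sum: "sum_mset P = n" and S: "S \<subseteq> set_mset P"
        using PS by (auto simp: overpartitions_def)
      obtain M where P: "P = mset_set S + M"
        using sub[OF S] by (auto simp: mset_subset_eq_exists_conv)
      have kA: "k \<in> A" if "k \<in># P" for k
        using le[OF that] pos that sum by (auto simp: A_def Suc_le_eq)
      have total: "\<Sum>S + sum_mset M = n" using sum P by (simp add: sum_S)
      have "set_mset M \<subseteq> B"
        using kA nd P by (auto simp: non_overlined_parts_def A_def B_def)
      moreover have "S \<subseteq> A" using kA S by auto
      ultimately show "(case x of (P, S) \<Rightarrow> (\<Sum>S, S, P - mset_set S)) \<in> ?T"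
        using total P xPS by (auto simp: distinct_in_def partitions_in_def)
    qed
    show "(\<lambda>(i, S, M). (M + mset_set S, S)) ` ?T \<subseteq> ?R"
    proof (rule image_subsetI)
      fix x assume x: "x \<in> ?T"
      obtain i S M where xi: "x = (i, S, M)" by (cases x)
      with x have i: "i \<le> n" and S: "S \<in> distinct_in A i" and M: "M \<in> partitions_in B (n - i)"
        by auto
      have "finite S" using S finite_subset by (auto simp: distinct_in_def A_def)
      then show "(case x of (i, S, M) \<Rightarrow> (M + mset_set S, S)) \<in> ?R"
        using i S M xi
        by (auto simp: overpartitions_def non_overlined_parts_def distinct_in_def partitions_in_def
            A_def B_def sum_S)
    qed
  qed
  then have "R_star l n = card ?T"
    unfolding R_star_def by (rule bij_betw_same_card)
  also have "\<dots> = (\<Sum>i\<le>n. card (distinct_in A i) * card (partitions_in B (n - i)))"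
    by (subst card_SigmaI)
      (auto simp: card_cartesian_product A_def B_def intro!: finite_distinct_in finite_partitions_in)
  finally show ?thesis .
qed

text \<open>One (q;q)_n meets the overlined parts through (1 + q^k)(1 - q^k) = 1 - q^(2k); the other
  cancels the non-overlined ones and leaves the multiples of l. Only part sizes up to n enter, so
  \<open>F\<close> depends on n.\<close>

lemma R_star_gf:
  fixes l n :: nat
  obtains F :: "int fps" where "fps_nth F n = int (R_star l n)"
    and "F * qpoch n * qpoch n
      = (\<Prod>k = 1..n. 1 - fps_X ^ (2 * k)) * (\<Prod>k | k \<in> {1..n} \<and> l dvd k. 1 - fps_X ^ k)"
proof -
  let ?A = "{1..n}" and ?B = "{k \<in> {1..n}. \<not> l dvd k}" and ?C = "{k \<in> {1..n}. l dvd k}"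
  let ?D = "Abs_fps (\<lambda>i. int (card (distinct_in ?A i)))"
  let ?P = "Abs_fps (\<lambda>i. int (card (partitions_in ?B i)))"
  let ?f = "\<lambda>k. 1 - fps_X ^ k :: int fps"
  have "fps_nth (?D * ?P) n = int (R_star l n)"
    by (simp add: fps_mult_nth card_R_star atMost_atLeast0)
  moreover have "?D * ?P * qpoch n * qpoch n = (\<Prod>k = 1..n. ?f (2 * k)) * prod ?f ?C"
  proof -
    have D: "?D * qpoch n = (\<Prod>k = 1..n. ?f (2 * k))"
      unfolding qpoch_def distinct_in_gf[OF finite_atLeastAtMost] prod.distrib [symmetric]
      by (intro prod.cong) (auto simp: algebra_simps power_even_eq power2_eq_square power_mult_distrib
          simp flip: power_add mult_2)
    have "qpoch n = prod ?f (?B \<union> ?C)"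
      unfolding qpoch_def by (intro prod.cong) auto
    also have "\<dots> = prod ?f ?B * prod ?f ?C"
      by (intro prod.union_disjoint) auto
    finally have "?P * qpoch n = ?P * prod ?f ?B * prod ?f ?C" by (simp add: mult.assoc)
    also have "\<dots> = prod ?f ?C" by (subst partitions_in_gf) auto
    finally have P: "?P * qpoch n = prod ?f ?C" .
    have "?D * ?P * qpoch n * qpoch n = (?D * qpoch n) * (?P * qpoch n)"
      by (simp only: mult_ac)
    then show ?thesis by (simp only: D P)
  qed
  ultimately show ?thesis using that by auto
qed

section \<open>The congruence\<close>

lemma qpoch_double: "qpoch (2 * n) = (\<Prod>i<n. 1 - fps_X ^ Suc (2 * i)) * (\<Prod>k = 1..n. 1 - fps_X ^ (2 * k))"
  by (induction n) (simp_all add: qpoch_Suc mult_ac del: power_Suc)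

text \<open>With E = (q;q)_n and U, V the odd and even factors, E (F E U) = U V G is congruent to E
  G. Cancelling the unit E and applying Gauss to E U gives the claim.\<close>

lemma R_star_cong_fps:
  fixes F G :: "int fps"
  assumes "F * qpoch n * qpoch n = (\<Prod>k = 1..n. 1 - fps_X ^ (2 * k)) * G"
  shows "fps_X ^ Suc n dvd F * (1 + 2 * pos_squares n) - G"
proof -
  define V :: "int fps" where "V = (\<Prod>k = 1..n. 1 - fps_X ^ (2 * k))"
  define U :: "int fps" where "U = (\<Prod>i<n. 1 - fps_X ^ Suc (2 * i))"
  let ?E = "qpoch n" and ?T = "1 + 2 * pos_squares n" and ?X = "fps_X ^ Suc n :: int fps"
  have 1: "?X dvd ?E * U - ?T"
    unfolding U_def by (rule gauss_squares_cong)
  have 2: "?X dvd U * V - ?E"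
    using qpoch_cong[of n "2 * n"] by (simp add: U_def V_def qpoch_double)
  have "?E * (F * ?E * U - G) = (U * V - ?E) * G"
    using assms by (simp add: V_def algebra_simps)
  then have "?X dvd ?E * (F * ?E * U - G)"
    using 2 by simp
  then have "?X dvd F * ?E * U - G"
    by (rule fps_X_power_dvd_cancel[rotated]) simp
  then have "?X dvd (F * ?E * U - G) - F * (?E * U - ?T)"
    by (rule dvd_diff[OF _ dvd_mult[OF 1]])
  then show ?thesis by (simp add: algebra_simps)
qed

text \<open>Exponents in the expansion are sums of elements of C, hence multiples of l.\<close>

lemma fps_nth_prod_eq_0:
  assumes "\<And>k. k \<in> C \<Longrightarrow> l dvd k" "\<not> l dvd i"
  shows "fps_nth (\<Prod>k\<in>C. 1 - fps_X ^ k :: int fps) i = 0"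
  using assms
proof (induction C arbitrary: i rule: infinite_finite_induct)
  case (insert k C)
  have "\<not> l dvd (i - k)" if "k \<le> i"
    using that insert.prems by (metis dvd_diffD insertI1)
  then show ?case
    using insert by (simp add: ring_distribs fps_X_power_mult_nth)
qed (auto intro!: gr0I)

lemma pos_squares_nth_eq_0:
  assumes "i mod 3 = 2"
  shows "fps_nth (pos_squares m) i = 0"
proof -
  have "fps_nth ((-1) ^ s * fps_X ^ (s\<^sup>2) :: int fps) i = 0" for s
  proof -
    have "s mod 3 = 0 \<or> s mod 3 = 1 \<or> s mod 3 = 2" by auto
    then have "s\<^sup>2 mod 3 \<noteq> 2" by (subst power_mod [symmetric]) auto
    then have "i \<noteq> s\<^sup>2" using assms by auto
    then show ?thesis by (cases "even s") (simp_all add: fps_X_power_nth)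
  qed
  then show ?thesis
    by (simp add: pos_squares_def fps_sum_nth)
qed

text \<open>The swap of j and i - j has no fixed point for odd i, so equal terms of the convolution
  pair up.\<close>

lemma even_fps_square_nth_odd:
  fixes f :: "int fps"
  assumes "odd i"
  shows "even (fps_nth (f\<^sup>2) i)"
proof -
  obtain r where i: "i = Suc (2 * r)" using assms by (metis oddE Suc_eq_plus1)
  let ?g = "\<lambda>j. fps_nth f j * fps_nth f (i - j)"
  have split: "{0..i} = {0..r} \<union> {Suc r..i}" using i by auto
  have "fps_nth (f\<^sup>2) i = sum ?g {0..r} + sum ?g {Suc r..i}"
    unfolding power2_eq_square fps_mult_nth split by (intro sum.union_disjoint) auto
  also have "sum ?g {Suc r..i} = sum ?g {0..r}"
    by (rule sum.reindex_bij_witness[of _ "\<lambda>j. i - j" "\<lambda>j. i - j"]) (auto simp: i)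
  finally show ?thesis by simp
qed

theorem theorem1p8:
  fixes n :: nat
  shows "[R_star 6 (6 * n + 5) = 0] (mod 8)"
proof -
  define N where "N = 6 * n + 5"
  define G :: "int fps" where "G = (\<Prod>k | k \<in> {1..N} \<and> 6 dvd k. 1 - fps_X ^ k)"
  define S where "S = pos_squares N"
  obtain F :: "int fps" where F: "fps_nth F N = int (R_star 6 N)"
    and FG: "F * qpoch N * qpoch N = (\<Prod>k = 1..N. 1 - fps_X ^ (2 * k)) * G"
    unfolding G_def by (rule R_star_gf)
  \<comment> \<open>By (1 + 2S)(1 - 2S + 4S^2) = 1 + 8S^3, \<open>H\<close> inverts 1 + 2S modulo
    8.\<close>
  define H where "H = 1 - 2 * S + 4 * S\<^sup>2"
  have "fps_X ^ Suc N dvd (F * (1 + 2 * S) - G) * H"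
    using R_star_cong_fps[OF FG] by (simp add: S_def)
  then have "fps_nth ((F * (1 + 2 * S) - G) * H) N = 0"
    by (rule fps_X_power_dvd_nth) simp
  moreover have "(F * (1 + 2 * S) - G) * H = F + fps_const 8 * (F * S ^ 3) - G * H"
    by (simp add: H_def algebra_simps power2_eq_square power3_eq_cube numeral_fps_const)
  ultimately have eq: "fps_nth F N = fps_nth (G * H) N - 8 * fps_nth (F * S ^ 3) N"
    by simp
  \<comment> \<open>At such i the constant 1 and the term 2S contribute nothing, and 4S^2
    contributes 4 times an even number.\<close>
  have H8: "8 dvd fps_nth H i" if "i mod 6 = 5" for i
  proof -
    have "i mod 3 = 2" "odd i" "i \<noteq> 0" using that by presburger+
    then have "fps_nth S i = 0" "even (fps_nth (S\<^sup>2) i)"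
      by (auto simp: S_def pos_squares_nth_eq_0 even_fps_square_nth_odd)
    moreover have "H = 1 - fps_const 2 * S + fps_const 4 * S\<^sup>2"
      by (simp add: H_def numeral_fps_const)
    ultimately show ?thesis using \<open>i \<noteq> 0\<close> by (auto elim!: evenE)
  qed
  have "8 dvd fps_nth (G * H) N"
    unfolding fps_mult_nth
  proof (rule dvd_sum)
    fix i assume "i \<in> {0..N}"
    \<comment> \<open>\<open>G\<close> is a series in q^6, and N is 5 modulo 6, so a nonzero
      coefficient of \<open>G\<close> meets an index of \<open>H\<close> that is 5 modulo 6.\<close>
    show "8 dvd fps_nth G i * fps_nth H (N - i)"
    proof (cases "6 dvd i")
      case True
      then obtain j where "i = 6 * j" by (elim dvdE)
      moreover from this have "j \<le> n" using \<open>i \<in> {0..N}\<close> by (simp add: N_def)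
      ultimately have "N - i = 6 * (n - j) + 5" by (simp add: N_def)
      then have "(N - i) mod 6 = 5" by simp
      then show ?thesis using H8 by simp
    next
      case False
      then have "fps_nth G i = 0"
        unfolding G_def by (intro fps_nth_prod_eq_0) auto
      then show ?thesis by simp
    qed
  qed
  then have "8 dvd int (R_star 6 N)"
    unfolding F [symmetric] eq by (intro dvd_diff) auto
  then have "8 dvd R_star 6 N"
    by presburger
  then show ?thesis
    by (simp add: N_def cong_0_iff)
qed

end
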